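(* Let $p>1$, $h>0$, $\kappa\in\{-1,1\}$, $\sigma\in\mathbb{R}$, and set $\lambda=-\kappa h^{-1}-i\sigma$ and $$A(\lambda)=\frac{e^{-i\pi/4}\sqrt2\,\Gamma(\frac34-\frac12 i\lambda)}{\Gamma(\frac14-\frac12 i\lambda)}.$$ If $\kappa=1$, then for each $0<h<\infty$ there exists a unique $\sigma(h)\in(0,1)$ such that $A(\lambda)$ is real and positive, and thus there is a corresponding (nontrivial) outgoing solution $\varphi_{h,1,\sigma(h)}$. If $\kappa=-1$, then for each $h>0$ and each $0<\sigma<1$, $A(\lambda)$ is not real and positive, and thus there are no (nontrivial) outgoing solutions $\varphi_{h,-1,\sigma}$.
   Context: Let $D_\nu(z)$ denote the standard parabolic cylinder (Weber) function: for $\Re\nu<0$, $D_\nu(z)=\frac{e^{-z^2/4}}{\Gamma(-\nu)}\int_0^\infty e^{-zt}e^{-t^2/2}t^{-\nu-1}\,dt$, extended analytically to all $\nu\in\mathbb{C}$; it solves $\gamma''+(\nu+\frac12-\frac14z^2)\gamma=0$. Define $w(z,\lambda)=D_{i\lambda-\frac12}(e^{-i\pi/4}h^{1/2}z)$, which solves $-w_{zz}-\frac14h^2z^2w=h\lambda w$. Consider the equation $$(\kappa+ih\sigma)\varphi-\varphi_{zz}-\tfrac14h^2z^2\varphi-\delta|\varphi|^{p-1}\varphi=0,$$ where $\delta$ is the Dirac delta at $0$; it means the equation without the $\delta$ term holds for $z\ne0$, $\varphi$ is continuous at $0$, and $\varphi_z(0+)-\varphi_z(0-)=-|\varphi(0)|^{p-1}\varphi(0)$.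 A solution $\varphi$ of this equation is called outgoing if there are constants $\alpha_\pm\in\mathbb{C}$ with $\varphi(z)=\alpha_+w(z,\lambda)$ for $z>0$ and $\varphi(z)=\alpha_-w(-z,\lambda)$ for $z<0$, where $\lambda=-\kappa h^{-1}-i\sigma$. $\varphi_{h,\kappa,\sigma}$ denotes a nontrivial outgoing solution for the parameters $h,\kappa,\sigma$. *)

theory Defs
  imports "HOL-Analysis.Analysis"
begin

text \<open>Parabolic cylinder (Weber) function D_nu(z): the unique function, entire in nu
  for every fixed z, which for Re nu < 0 is given by the integral representation.\<close>
definition pcf :: "complex \<Rightarrow> complex \<Rightarrow> complex" where
  "pcf = (THE D.
     (\<forall>\<nu> z. Re \<nu> < 0 \<longrightarrow>
        D \<nu> z = exp (- z\<^sup>2 / 4) / Gamma (- \<nu>) *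
          integral {0<..} (\<lambda>t::real. exp (- z * of_real t) * exp (- (of_real t)\<^sup>2 / 2)
                                     * (of_real t) powr (- \<nu> - 1))) \<and>
     (\<forall>z. (\<lambda>\<nu>. D \<nu> z) holomorphic_on UNIV))"

definition wfun :: "real \<Rightarrow> complex \<Rightarrow> real \<Rightarrow> complex" where
  "wfun h lam x = pcf (\<i> * lam - 1/2) (exp (- \<i> * of_real pi / 4) * of_real (sqrt h) * of_real x)"

definition lam_of :: "real \<Rightarrow> real \<Rightarrow> real \<Rightarrow> complex" where
  "lam_of h \<kappa> \<sigma> = - of_real (\<kappa> / h) - \<i> * of_real \<sigma>"

definition Acoef :: "complex \<Rightarrow> complex" where
  "Acoef lam = exp (- \<i> * of_real pi / 4) * of_real (sqrt 2) * Gamma (3/4 - \<i> * lam / 2)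
               / Gamma (1/4 - \<i> * lam / 2)"

text \<open>Solution of (kappa + i h sigma) phi - phi'' - h^2 z^2/4 phi - delta |phi|^(p-1) phi = 0
  on the real line: the ODE holds for z /= 0, phi is continuous at 0, and the one-sided
  derivatives at 0 satisfy phi'(0+) - phi'(0-) = -|phi(0)|^(p-1) phi(0).\<close>
definition delta_solution :: "real \<Rightarrow> real \<Rightarrow> real \<Rightarrow> real \<Rightarrow> (real \<Rightarrow> complex) \<Rightarrow> bool" where
  "delta_solution p h \<kappa> \<sigma> \<phi> \<longleftrightarrow>
     (\<exists>\<phi>1 \<phi>2. \<forall>z. z \<noteq> 0 \<longrightarrow>
        (\<phi> has_vector_derivative \<phi>1 z) (at z) \<and>
        (\<phi>1 has_vector_derivative \<phi>2 z) (at z) \<and>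
        (of_real \<kappa> + \<i> * of_real (h * \<sigma>)) * \<phi> z - \<phi>2 z
          - of_real (h\<^sup>2 * z\<^sup>2 / 4) * \<phi> z = 0) \<and>
     continuous (at 0) \<phi> \<and>
     (\<exists>dp dm. (\<phi> has_vector_derivative dp) (at 0 within {0..}) \<and>
              (\<phi> has_vector_derivative dm) (at 0 within {..0}) \<and>
              dp - dm = - of_real (cmod (\<phi> 0) powr (p - 1)) * \<phi> 0)"

definition outgoing :: "real \<Rightarrow> real \<Rightarrow> real \<Rightarrow> real \<Rightarrow> (real \<Rightarrow> complex) \<Rightarrow> bool" where
  "outgoing p h \<kappa> \<sigma> \<phi> \<longleftrightarrow> delta_solution p h \<kappa> \<sigma> \<phi> \<and>
     (\<exists>ap am. (\<forall>z>0. \<phi> z = ap * wfun h (lam_of h \<kappa> \<sigma>) z) \<and>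
              (\<forall>z<0. \<phi> z = am * wfun h (lam_of h \<kappa> \<sigma>) (- z)))"

end

theory Submission
  imports Defs "HOL-Complex_Analysis.Complex_Analysis"
begin

text \<open>
  Matching an outgoing solution at the origin shows that the logarithmic derivative of w there is
  -sqrt h * A(lambda), so a nontrivial outgoing solution exists exactly when A(lambda) is real and
  positive; this needs the Taylor expansion of the Weber function, obtained by expanding
  exp (-z t) under the integral and then continuing in nu.

  Up to the factor sqrt 2 * exp (-i pi/4), A(lambda) is R(x) = Gamma(x + 1/2 + i b) / Gamma(x + i b)
  with x = 1/4 - sigma/2 and b = kappa/(2h). For b > 0 the product formula for Gamma gives R(x) the argument
  theta(x) = sum over k of arctan ((x + k + 1/2)/b) - arctan ((x + k)/b),
  which consists of every second term of a positive telescoping series and hence lies in (0, pi), and whose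
  terms all decrease strictly in x for x > -1/4. At x = 1/4 and x = -1/4 the reflection formula
  puts theta below and above pi/4, respectively. For b < 0 the argument is -theta, and -theta - pi/4
  is never a multiple of 2 pi.
\<close>

section \<open>Taylor expansion of the parabolic cylinder function\<close>

text \<open>Taylor coefficients of exp (z^2/4) D_nu(z), which solves y'' - z y' + nu y = 0; the
  first two are D_nu(0) and D_nu'(0).\<close>
fun pcf_coeff :: "complex \<Rightarrow> nat \<Rightarrow> complex" where
  "pcf_coeff \<nu> 0 = of_real (sqrt pi) * 2 powr (\<nu> / 2) * rGamma ((1 - \<nu>) / 2)"
| "pcf_coeff \<nu> (Suc 0) = - of_real (sqrt pi) * 2 powr ((\<nu> + 1) / 2) * rGamma (- \<nu> / 2)"
| "pcf_coeff \<nu> (Suc (Suc n)) = (of_nat n - \<nu>) / (of_nat (n + 1) * of_nat (n + 2)) * pcf_coeff \<nu> n"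

section \<open>Locally uniform convergence of the Taylor series in nu\<close>

text \<open>A ratio test for recurrences that link index n + 2 to index n, as in
  \<open>pcf_coeff\<close>. Once \<open>q n < 1/4\<close>, two steps cost a factor 1/4, so the tail
  lies below a geometric sequence of ratio 1/2.\<close>

lemma summable_two_step_ratio:
  fixes u q :: "nat \<Rightarrow> real"
  assumes nonneg: "\<And>n. 0 \<le> u n"
    and step: "\<And>n. u (Suc (Suc n)) \<le> q n * u n"
    and lim: "q \<longlonglongrightarrow> 0"
  shows "summable u"
proof -
  have "eventually (\<lambda>n. q n < 1/4) sequentially"
    using lim by (rule order_tendstoD) simp
  then obtain N where N: "\<And>n. n \<ge> N \<Longrightarrow> q n < 1/4"
    unfolding eventually_sequentially by blast
  \<comment> \<open>The factor 2 makes the odd half of the bound,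
    \<open>u (Suc N) \<le> B * (1/2)\<close>, hold at the start.\<close>
  define B where "B = max (u N) (2 * u (Suc N))"
  have bound: "u (N + k) \<le> B * (1/2) ^ k \<and> u (Suc (N + k)) \<le> B * (1/2) ^ Suc k" for k
  proof (induction k)
    case 0
    show ?case unfolding B_def by (auto simp: max_def)
  next
    case (Suc k)
    have "u (Suc (Suc (N + k))) \<le> q (N + k) * u (N + k)"
      by (rule step)
    also have "\<dots> \<le> 1/4 * u (N + k)"
      using N[of "N + k"] nonneg by (intro mult_right_mono) auto
    also have "\<dots> \<le> 1/4 * (B * (1/2) ^ k)"
      using Suc by simp
    finally show ?case
      using Suc by simp
  qed
  have "norm (u (k + N)) \<le> B * (1/2) ^ k" for k
    using bound[of k] nonneg[of "N + k"] by (simp add: add.commute)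
  then have "summable (\<lambda>k. u (k + N))"
    by (intro summable_comparison_test[OF _ summable_mult[OF summable_geometric]]) auto
  then show ?thesis
    by (rule summable_iff_shift[THEN iffD1])
qed

lemma LIMSEQ_pcf_coeff_ratio:
  "(\<lambda>n. (real n + R) / (real (n + 1) * real (n + 2)) * c) \<longlonglongrightarrow> 0"
  by real_asymp

lemma holomorphic_pcf_coeff: "(\<lambda>\<nu>. pcf_coeff \<nu> n) holomorphic_on A"
proof (induction n rule: induct_nat_012)
  case (ge2 n)
  have "(of_nat (n + 1) * of_nat (n + 2) :: complex) \<noteq> 0"
    unfolding of_nat_mult[symmetric] of_nat_eq_0_iff by simp
  then show ?case
    unfolding pcf_coeff.simps by (intro holomorphic_intros ge2) auto
qed (auto intro!: holomorphic_intros)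

text \<open>The explicit candidate for the function singled out by the \<open>THE\<close> in
  \<open>pcf\<close>.\<close>

definition pcf_series :: "complex \<Rightarrow> complex \<Rightarrow> complex" where
  "pcf_series \<nu> z = exp (- z\<^sup>2 / 4) * (\<Sum>n. pcf_coeff \<nu> n * z ^ n)"

text \<open>Supplies the majorant for the Weierstrass M-test. The suprema over the ball inherit the
  two-step recurrence as an inequality, so \<open>summable_two_step_ratio\<close> applies to
  them.\<close>

lemma pcf_coeff_bounded_on_cball:
  obtains M where "summable M" "\<And>n \<nu>. \<nu> \<in> cball x 1 \<Longrightarrow> norm (pcf_coeff \<nu> n * z ^ n) \<le> M n"
proof -
  define R where "R = norm x + 1"
  have R: "norm \<nu> \<le> R" if "\<nu> \<in> cball x 1" for \<nu>
    using that norm_triangle_ineq2[of \<nu> x] by (auto simp: R_def dist_norm norm_minus_commute)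
  have bdd: "\<exists>B. \<forall>\<nu>\<in>cball x 1. norm (pcf_coeff \<nu> n * z ^ n) \<le> B" for n
  proof -
    have "continuous_on (cball x 1) (\<lambda>\<nu>. pcf_coeff \<nu> n * z ^ n)"
      by (intro holomorphic_on_imp_continuous_on holomorphic_intros holomorphic_pcf_coeff)
    then have "bounded ((\<lambda>\<nu>. pcf_coeff \<nu> n * z ^ n) ` cball x 1)"
      by (intro compact_imp_bounded compact_continuous_image) auto
    then show ?thesis
      unfolding bounded_iff by auto
  qed
  define M where "M n = (SUP \<nu>\<in>cball x 1. norm (pcf_coeff \<nu> n * z ^ n))" for n
  have le: "norm (pcf_coeff \<nu> n * z ^ n) \<le> M n" if "\<nu> \<in> cball x 1" for \<nu> n
    unfolding M_def by (rule cSUP_upper) (use that bdd[of n] in \<open>auto simp: bdd_above_def\<close>)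
  have nonneg: "0 \<le> M n" for n
    using le[of x n] order_trans[OF norm_ge_zero] by simp
  have "summable M"
  proof (rule summable_two_step_ratio[OF nonneg])
    fix n
    show "M (Suc (Suc n)) \<le> (real n + R) / (real (n + 1) * real (n + 2)) * norm z ^ 2 * M n"
      unfolding M_def[of "Suc (Suc n)"]
    proof (rule cSUP_least)
      fix \<nu> assume \<nu>: "\<nu> \<in> cball x 1"
      have "norm (of_nat n - \<nu>) \<le> real n + R"
        using norm_triangle_ineq4[of "of_nat n" \<nu>] R[OF \<nu>] by simp
      then have "norm (of_nat n - \<nu>) / (real (n + 1) * real (n + 2)) * norm z ^ 2 * norm (pcf_coeff \<nu> n * z ^ n)
          \<le> (real n + R) / (real (n + 1) * real (n + 2)) * norm z ^ 2 * M n"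
        using le[OF \<nu>] by (intro mult_mono divide_right_mono) (auto simp: R_def)
      moreover have "norm (pcf_coeff \<nu> (Suc (Suc n)) * z ^ Suc (Suc n)) =
          norm (of_nat n - \<nu>) / (real (n + 1) * real (n + 2)) * norm z ^ 2 * norm (pcf_coeff \<nu> n * z ^ n)"
        unfolding pcf_coeff.simps norm_mult norm_divide norm_power norm_of_nat
        by (simp add: power2_eq_square)
      ultimately show "norm (pcf_coeff \<nu> (Suc (Suc n)) * z ^ Suc (Suc n)) \<le>
          (real n + R) / (real (n + 1) * real (n + 2)) * norm z ^ 2 * M n"
        by simp
    qed simp
  qed (rule LIMSEQ_pcf_coeff_ratio)
  then show thesis
    using le that by blast
qed

lemma summable_pcf_coeff: "summable (\<lambda>n. pcf_coeff \<nu> n * z ^ n)"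
proof -
  obtain M where M: "summable M" "\<And>n \<mu>. \<mu> \<in> cball \<nu> 1 \<Longrightarrow> norm (pcf_coeff \<mu> n * z ^ n) \<le> M n"
    using pcf_coeff_bounded_on_cball by blast
  have "norm (pcf_coeff \<nu> n * z ^ n) \<le> M n" for n
    by (rule M(2)) simp
  then show ?thesis
    by (intro summable_comparison_test[OF _ M(1)] exI[of _ 0]) blast
qed

text \<open>The partial sums are holomorphic in nu and converge locally uniformly. This is the
  entireness that the definition of \<open>pcf\<close> demands.\<close>

lemma holomorphic_pcf_series: "(\<lambda>\<nu>. pcf_series \<nu> z) holomorphic_on UNIV"
proof -
  have "(\<lambda>\<nu>. \<Sum>n. pcf_coeff \<nu> n * z ^ n) holomorphic_on UNIV"
  proof (rule holomorphic_uniform_sequence[OF open_UNIV])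
    show "(\<lambda>\<nu>. \<Sum>i<n. pcf_coeff \<nu> i * z ^ i) holomorphic_on UNIV" for n
      by (intro holomorphic_intros holomorphic_pcf_coeff)
  next
    fix x :: complex
    obtain M where "summable M" "\<And>n \<nu>. \<nu> \<in> cball x 1 \<Longrightarrow> norm (pcf_coeff \<nu> n * z ^ n) \<le> M n"
      using pcf_coeff_bounded_on_cball by blast
    then have "uniform_limit (cball x 1) (\<lambda>n \<nu>. \<Sum>i<n. pcf_coeff \<nu> i * z ^ i)
        (\<lambda>\<nu>. \<Sum>n. pcf_coeff \<nu> n * z ^ n) sequentially"
      by (intro Weierstrass_m_test) auto
    then show "\<exists>d>0. cball x d \<subseteq> UNIV \<and> uniform_limit (cball x d)
        (\<lambda>n \<nu>. \<Sum>i<n. pcf_coeff \<nu> i * z ^ i) (\<lambda>\<nu>. \<Sum>n. pcf_coeff \<nu> n * z ^ n) sequentially"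
      by (intro exI[of _ 1]) auto
  qed
  then show ?thesis
    unfolding pcf_series_def by (intro holomorphic_intros)
qed

section \<open>Gaussian moments as values of Gamma\<close>

text \<open>The substitution u = t^2/2 in the Gamma integral at s/2, with Jacobian |t|. The
  parameter \<open>a\<close> allows a weaker Gaussian, which later serves as a dominating
  function.\<close>

lemma gaussian_moment_substitution:
  assumes "t > 0"
  shows "\<bar>t\<bar> *\<^sub>R (complex_of_real (t\<^sup>2 / 2) powr (s / 2 - 1) / of_real (exp (a * (t\<^sup>2 / 2)))) =
    2 powr (1 - s / 2) * (of_real t powr (s - 1) * of_real (exp (- a * t\<^sup>2 / 2)))"
proof -
  have ln: "ln (t\<^sup>2 / 2) = 2 * ln t - ln 2"
    using assms by (simp add: ln_div ln_realpow)
  have L2: "Ln (2::complex) = of_real (ln 2)"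
    using Ln_of_real[of 2] by simp
  have t: "of_real t = exp (complex_of_real (ln t))"
    using assms by (simp add: exp_of_real)
  have p: "complex_of_real (t\<^sup>2 / 2) powr (s / 2 - 1) = exp ((s / 2 - 1) * of_real (2 * ln t - ln 2))"
    using assms ln Ln_of_real[of "t\<^sup>2/2"] by (simp add: powr_def)
  have q: "of_real t powr (s - 1) = exp ((s - 1) * complex_of_real (ln t))"
    using assms Ln_of_real[of t] by (simp add: powr_def)
  have r: "(2::complex) powr (1 - s / 2) = exp ((1 - s / 2) * of_real (ln 2))"
    using L2 by (simp add: powr_def)
  have "\<bar>t\<bar> *\<^sub>R (x / complex_of_real e) = (of_real t * x) * of_real (inverse e)" for x e
    unfolding scaleR_conv_of_real using assms by (simp add: field_simps)
  then have "\<bar>t\<bar> *\<^sub>R (complex_of_real (t\<^sup>2 / 2) powr (s / 2 - 1) / of_real (exp (a * (t\<^sup>2 / 2)))) =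
      (of_real t * complex_of_real (t\<^sup>2 / 2) powr (s / 2 - 1)) * of_real (inverse (exp (a * (t\<^sup>2 / 2))))"
    by this
  also have "inverse (exp (a * (t\<^sup>2 / 2))) = exp (- a * t\<^sup>2 / 2)"
    by (simp add: exp_minus)
  also have "of_real t * complex_of_real (t\<^sup>2 / 2) powr (s / 2 - 1) = 2 powr (1 - s / 2) * of_real t powr (s - 1)"
    unfolding p q r t[symmetric] unfolding t exp_add[symmetric]
    by (simp add: algebra_simps)
  finally show ?thesis
    by (simp only: mult.assoc)
qed

lemma half_square_image: "(\<lambda>t::real. t\<^sup>2 / 2) ` {0<..} = {0<..}"
proof (intro equalityI subsetI)
  fix u :: real assume "u \<in> {0<..}"
  then show "u \<in> (\<lambda>t. t\<^sup>2 / 2) ` {0<..}"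
    by (intro image_eqI[of _ _ "sqrt (2 * u)"]) auto
qed auto

lemma inj_half_square: "inj_on (\<lambda>t::real. t\<^sup>2 / 2) {0<..}"
  by (auto simp: inj_on_def power2_eq_iff_nonneg)

lemma absolutely_integrable_gaussian_moment:
  assumes "Re s > 0" "a > 0"
  shows "(\<lambda>t. complex_of_real t powr (s - 1) * of_real (exp (- a * t\<^sup>2 / 2))) absolutely_integrable_on {0<..}"
proof -
  let ?f = "\<lambda>u. complex_of_real u powr (s / 2 - 1) / of_real (exp (a * u))"
  have "?f absolutely_integrable_on {0<..}"
    using assms by (intro absolutely_integrable_Gamma_integral) auto
  then have "(\<lambda>t. \<bar>t\<bar> *\<^sub>R ?f (t\<^sup>2 / 2)) absolutely_integrable_on {0<..}"
    by (subst absolutely_integrable_change_of_variables_real[symmetric])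
       (auto simp: half_square_image inj_half_square intro!: derivative_eq_intros)
  then have "(\<lambda>t. 2 powr (1 - s / 2) * (complex_of_real t powr (s - 1) * of_real (exp (- a * t\<^sup>2 / 2))))
      absolutely_integrable_on {0<..}"
    by (rule absolutely_integrable_spike[OF _ negligible_empty])
       (use gaussian_moment_substitution in auto)
  from set_integrable_mult_right[OF this, of "inverse (2 powr (1 - s / 2))"] show ?thesis
    by (simp flip: mult.assoc)
qed

lemma has_integral_gaussian_moment:
  assumes "Re s > 0"
  shows "((\<lambda>t. complex_of_real t powr (s - 1) * of_real (exp (- t\<^sup>2 / 2)))
           has_integral 2 powr (s / 2 - 1) * Gamma (s / 2)) {0<..}"
proof -
  let ?f = "\<lambda>u. complex_of_real u powr (s / 2 - 1) / of_real (exp u)"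
  have "?f absolutely_integrable_on {0<..}" "integral {0<..} ?f = Gamma (s / 2)"
    using absolutely_integrable_Gamma_integral'[of "s/2"] Gamma_integral_complex'[of "s/2"] assms
    by (auto simp: integral_unique)
  then have "(\<lambda>t. \<bar>t\<bar> *\<^sub>R ?f (t\<^sup>2 / 2)) absolutely_integrable_on {0<..} \<and>
      integral {0<..} (\<lambda>t. \<bar>t\<bar> *\<^sub>R ?f (t\<^sup>2 / 2)) = Gamma (s / 2)"
    by (subst has_absolute_integral_change_of_variables_real)
       (auto simp: half_square_image inj_half_square intro!: derivative_eq_intros)
  then have "((\<lambda>t. \<bar>t\<bar> *\<^sub>R ?f (t\<^sup>2 / 2)) has_integral Gamma (s / 2)) {0<..}"
    using set_lebesgue_integral_eq_integral(1) by (auto simp: has_integral_iff)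
  then have "((\<lambda>t. 2 powr (1 - s / 2) * (complex_of_real t powr (s - 1) * of_real (exp (- t\<^sup>2 / 2))))
      has_integral Gamma (s / 2)) {0<..}"
    by (rule has_integral_eq[rotated]) (use gaussian_moment_substitution[where a=1] in auto)
  from has_integral_mult_right[OF this, of "inverse (2 powr (1 - s / 2))"]
  have "((\<lambda>t. complex_of_real t powr (s - 1) * of_real (exp (- t\<^sup>2 / 2)))
      has_integral inverse (2 powr (1 - s / 2)) * Gamma (s / 2)) {0<..}"
    by (simp flip: mult.assoc)
  moreover have "inverse (2 powr (1 - s / 2)) = (2::complex) powr (s / 2 - 1)"
    by (simp flip: powr_minus)
  ultimately show ?thesis
    by metis
qed

lemma not_nonpos_Int_complexI: "Re s > 0 \<or> Im s \<noteq> 0 \<Longrightarrow> s \<notin> \<int>\<^sub>\<le>\<^sub>0"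
  by (auto elim!: nonpos_Ints_cases)

text \<open>Legendre duplication at -nu/2. It reconciles the reciprocal Gamma values in the first
  two coefficients with the moments of the integral.\<close>

lemma Gamma_half_duplication:
  assumes "Re \<nu> < 0"
  shows "Gamma (- \<nu> / 2) * Gamma ((1 - \<nu>) / 2) = 2 powr (1 + \<nu>) * of_real (sqrt pi) * Gamma (- \<nu>)"
proof -
  have "Ln (2::complex) = of_real (ln 2)"
    using Ln_of_real[of 2] by simp
  then show ?thesis
    using Gamma_legendre_duplication[of "- \<nu> / 2"] assms
    by (simp add: not_nonpos_Int_complexI powr_def diff_divide_distrib)
qed

text \<open>The right-hand side is what termwise integration of exp (-z t) produces. Duplication
  settles n = 0 and n = 1; after that, raising n by 2 raises the Gamma argument by 1, and the
  functional equation together with the doubled power of 2 yields the factor n - nu.\<close>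

lemma pcf_coeff_eq_moment:
  assumes "Re \<nu> < 0"
  shows "pcf_coeff \<nu> n =
    (- 1) ^ n / fact n * (2 powr ((of_nat n - \<nu>) / 2 - 1) * Gamma ((of_nat n - \<nu>) / 2)) / Gamma (- \<nu>)"
proof (induction n rule: induct_nat_012)
  case 0
  have nz: "Gamma (- \<nu>) \<noteq> 0" "Gamma ((1 - \<nu>) / 2) \<noteq> 0"
    using assms by (simp_all add: Gamma_eq_zero_iff not_nonpos_Int_complexI)
  have quot: "Gamma (- \<nu> / 2) / Gamma (- \<nu>) = 2 powr (1 + \<nu>) * of_real (sqrt pi) / Gamma ((1 - \<nu>) / 2)"
    using Gamma_half_duplication[OF assms] nz by (simp add: field_simps)
  have "(2::complex) powr (- \<nu> / 2 - 1) * 2 powr (1 + \<nu>) = 2 powr (\<nu> / 2)"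
    by (simp flip: powr_add)
  then have "2 powr (- \<nu> / 2 - 1) * (Gamma (- \<nu> / 2) / Gamma (- \<nu>)) =
      2 powr (\<nu> / 2) * of_real (sqrt pi) / Gamma ((1 - \<nu>) / 2)"
    unfolding quot by (simp flip: mult.assoc)
  then show ?case
    by (simp add: rGamma_inverse_Gamma inverse_eq_divide mult_ac)
next
  case 1
  have nz: "Gamma (- \<nu>) \<noteq> 0" "Gamma (- \<nu> / 2) \<noteq> 0"
    using assms by (simp_all add: Gamma_eq_zero_iff not_nonpos_Int_complexI)
  have quot: "Gamma ((1 - \<nu>) / 2) / Gamma (- \<nu>) = 2 powr (1 + \<nu>) * of_real (sqrt pi) / Gamma (- \<nu> / 2)"
    using Gamma_half_duplication[OF assms] nz by (simp add: field_simps)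
  have "(2::complex) powr ((1 - \<nu>) / 2 - 1) * 2 powr (1 + \<nu>) = 2 powr ((\<nu> + 1) / 2)"
    by (simp add: field_simps flip: powr_add)
  then have "2 powr ((1 - \<nu>) / 2 - 1) * (Gamma ((1 - \<nu>) / 2) / Gamma (- \<nu>)) =
      2 powr ((\<nu> + 1) / 2) * of_real (sqrt pi) / Gamma (- \<nu> / 2)"
    unfolding quot by (simp flip: mult.assoc)
  then show ?case
    by (simp add: rGamma_inverse_Gamma inverse_eq_divide mult_ac)
next
  case (ge2 n)
  have idx: "(of_nat (Suc (Suc n)) - \<nu>) / 2 = (of_nat n - \<nu>) / 2 + 1"
    by (simp add: field_simps)
  have G: "Gamma ((of_nat (Suc (Suc n)) - \<nu>) / 2) = (of_nat n - \<nu>) / 2 * Gamma ((of_nat n - \<nu>) / 2)"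
    unfolding idx using assms by (intro Gamma_plus1 not_nonpos_Int_complexI) simp
  have "(of_nat (Suc (Suc n)) - \<nu>) / 2 - 1 = ((of_nat n - \<nu>) / 2 - 1) + 1"
    by (simp add: field_simps)
  then have P: "(2::complex) powr ((of_nat (Suc (Suc n)) - \<nu>) / 2 - 1) = 2 powr ((of_nat n - \<nu>) / 2 - 1) * 2"
    by (simp only: powr_add) simp
  have F: "(fact (Suc (Suc n)) :: complex) = of_nat (n + 1) * of_nat (n + 2) * fact n"
    by (simp add: algebra_simps)
  show ?case
    unfolding pcf_coeff.simps ge2 G P F by (simp add: mult_ac)
qed

section \<open>The integral representation and its continuation in nu\<close>

lemma norm_exp_partial_sum_le: "norm (\<Sum>n<k. (w::complex) ^ n / fact n) \<le> exp (norm w)"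
proof -
  have "norm (\<Sum>n<k. w ^ n / fact n) \<le> (\<Sum>n<k. norm w ^ n / fact n)"
    by (rule order_trans[OF norm_sum]) (simp add: norm_divide norm_power)
  moreover have "(\<lambda>n. norm w ^ n / fact n) sums exp (norm w)"
    using exp_converges[of "norm w"] by (simp add: divide_inverse mult.commute)
  then have "(\<Sum>n<k. norm w ^ n / fact n) \<le> exp (norm w)"
    using sum_le_suminf[of "\<lambda>n. norm w ^ n / fact n" "{..<k}"] by (simp add: sums_iff)
  ultimately show ?thesis
    by linarith
qed

text \<open>Expand exp (-z t), integrate each term as a Gaussian moment, and pass to the limit by
  dominated convergence.\<close>

lemma has_integral_weber:
  assumes \<nu>: "Re \<nu> < 0"
  shows "((\<lambda>t. exp (- z * of_real t) * exp (- (of_real t)\<^sup>2 / 2) * of_real t powr (- \<nu> - 1))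
    has_integral Gamma (- \<nu>) * (\<Sum>n. pcf_coeff \<nu> n * z ^ n)) {0<..}"
proof (rule has_integral_dominated_convergence)
  define m where "m n = 2 powr ((of_nat n - \<nu>) / 2 - 1) * Gamma ((of_nat n - \<nu>) / 2)" for n
  let ?g = "\<lambda>n t. complex_of_real t powr ((of_nat n - \<nu>) - 1) * of_real (exp (- t\<^sup>2 / 2))"
  let ?f = "\<lambda>k t. \<Sum>n<k. (- z) ^ n / fact n * ?g n t"
  let ?h = "\<lambda>t. exp ((norm z)\<^sup>2) * norm (complex_of_real t powr (- \<nu> - 1) * of_real (exp (- (1/2) * t\<^sup>2 / 2)))"
  have "((\<lambda>t. (- z) ^ n / fact n * ?g n t) has_integral (- z) ^ n / fact n * m n) {0<..}" for n
    unfolding m_def using \<nu> by (intro has_integral_mult_right has_integral_gaussian_moment) simp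
  then show "(?f k has_integral (\<Sum>n<k. (- z) ^ n / fact n * m n)) {0<..}" for k
    by (intro has_integral_sum) auto
  have factor: "?f k t = (\<Sum>n<k. (- z * of_real t) ^ n / fact n) * (of_real t powr (- \<nu> - 1) * of_real (exp (- t\<^sup>2 / 2)))"
    if "t > 0" for k t
  proof -
    have "of_real t powr ((of_nat n - \<nu>) - 1) = of_real t ^ n * complex_of_real t powr (- \<nu> - 1)" for n
    proof -
      have "of_real t powr ((of_nat n - \<nu>) - 1) = complex_of_real t powr (of_nat n + (- \<nu> - 1))"
        by (simp add: algebra_simps)
      also have "\<dots> = of_real t ^ n * complex_of_real t powr (- \<nu> - 1)"
        unfolding powr_add using that by (simp add: powr_nat')
      finally show ?thesis .
    qed
    then show ?thesis
      unfolding sum_distrib_right power_mult_distrib by (simp add: mult.assoc)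
  qed
  have "(\<lambda>t. complex_of_real t powr (- \<nu> - 1) * of_real (exp (- (1/2) * t\<^sup>2 / 2))) absolutely_integrable_on {0<..}"
    using \<nu> by (intro absolutely_integrable_gaussian_moment) auto
  then have "(\<lambda>t. norm (complex_of_real t powr (- \<nu> - 1) * of_real (exp (- (1/2) * t\<^sup>2 / 2)))) integrable_on {0<..}"
    unfolding absolutely_integrable_on_def by blast
  from integrable_cmul[OF this, of "exp ((norm z)\<^sup>2)"] show "?h integrable_on {0<..}"
    by (simp only: real_scaleR_def)
  show "\<forall>t\<in>{0<..}. norm (?f k t) \<le> ?h t" for k
  proof
    fix t :: real assume "t \<in> {0<..}"
    then have t: "t > 0" by simp
    \<comment> \<open>Hence |z| t is at most |z|^2 + t^2/4: half of the Gaussian exponent absorbs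
      exp (|z| t), and the remaining half keeps \<open>?h\<close> integrable.\<close>
    have "0 \<le> (norm z - t / 2)\<^sup>2"
      by simp
    then have "norm z * t - t\<^sup>2 / 2 \<le> (norm z)\<^sup>2 - (1/2) * t\<^sup>2 / 2"
      by (simp add: power2_diff power_divide)
    then have "exp (norm z * t) * exp (- t\<^sup>2 / 2) \<le> exp ((norm z)\<^sup>2) * exp (- (1/2) * t\<^sup>2 / 2)"
      unfolding exp_add[symmetric] by simp
    moreover have "norm (\<Sum>n<k. (- z * of_real t) ^ n / fact n) \<le> exp (norm z * t)"
      using norm_exp_partial_sum_le[of "- z * of_real t" k] t by (simp add: norm_mult)
    ultimately have "norm (\<Sum>n<k. (- z * of_real t) ^ n / fact n) * exp (- t\<^sup>2 / 2)
        \<le> exp ((norm z)\<^sup>2) * exp (- (1/2) * t\<^sup>2 / 2)"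
      by (meson exp_ge_zero mult_right_mono order_trans)
    from mult_right_mono[OF this norm_ge_zero[of "complex_of_real t powr (- \<nu> - 1)"]]
    show "norm (?f k t) \<le> ?h t"
      unfolding factor[OF t] norm_mult by (simp add: mult_ac)
  qed
  show "\<forall>t\<in>{0<..}. (\<lambda>k. ?f k t) \<longlonglongrightarrow>
      exp (- z * of_real t) * exp (- (of_real t)\<^sup>2 / 2) * of_real t powr (- \<nu> - 1)"
  proof
    fix t :: real assume "t \<in> {0<..}"
    then have t: "t > 0" by simp
    have "(\<lambda>k. \<Sum>n<k. (- z * of_real t) ^ n / fact n) \<longlonglongrightarrow> exp (- z * of_real t)"
      using exp_converges[of "- z * of_real t"]
      by (simp add: sums_def scaleR_conv_of_real inverse_eq_divide)
    then have "(\<lambda>k. ?f k t) \<longlonglongrightarrow> exp (- z * of_real t) * (of_real t powr (- \<nu> - 1) * of_real (exp (- t\<^sup>2 / 2)))"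
      unfolding factor[OF t] by (rule tendsto_mult_right)
    then show "(\<lambda>k. ?f k t) \<longlonglongrightarrow> exp (- z * of_real t) * exp (- (of_real t)\<^sup>2 / 2) * of_real t powr (- \<nu> - 1)"
      by (simp add: mult_ac flip: exp_of_real)
  qed
  have eq: "Gamma (- \<nu>) * (pcf_coeff \<nu> n * z ^ n) = (- z) ^ n / fact n * m n" for n
  proof -
    have "Gamma (- \<nu>) \<noteq> 0"
      using \<nu> by (simp add: Gamma_eq_zero_iff not_nonpos_Int_complexI)
    then show ?thesis
      unfolding pcf_coeff_eq_moment[OF \<nu>] m_def[symmetric] power_minus[of z] by simp
  qed
  show "(\<lambda>k. \<Sum>n<k. (- z) ^ n / fact n * m n) \<longlonglongrightarrow> Gamma (- \<nu>) * (\<Sum>n. pcf_coeff \<nu> n * z ^ n)"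
    using sums_mult[OF summable_sums[OF summable_pcf_coeff[of \<nu> z]], of "Gamma (- \<nu>)"]
    unfolding sums_def eq .
qed

text \<open>Existence comes from the integral representation and from entireness in nu. Uniqueness
  is the identity theorem: two candidates agree on the half-plane Re nu < 0, hence
  everywhere.\<close>

lemma pcf_eq_pcf_series: "pcf = pcf_series"
  unfolding pcf_def
proof (rule the_equality, goal_cases)
  case 1
  show ?case
  proof (intro conjI allI impI holomorphic_pcf_series)
    fix \<nu> z :: complex assume "Re \<nu> < 0"
    moreover from this have "Gamma (- \<nu>) \<noteq> 0"
      by (simp add: Gamma_eq_zero_iff not_nonpos_Int_complexI)
    ultimately show "pcf_series \<nu> z = exp (- z\<^sup>2 / 4) / Gamma (- \<nu>) *
        integral {0<..} (\<lambda>t. exp (- z * of_real t) * exp (- (of_real t)\<^sup>2 / 2) * of_real t powr (- \<nu> - 1))"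
      by (subst integral_unique[OF has_integral_weber]) (auto simp: pcf_series_def)
  qed
next
  case (2 D)
  have "D \<nu> z = pcf_series \<nu> z" for \<nu> z
  proof -
    have "(\<lambda>\<nu>. D \<nu> z - pcf_series \<nu> z) holomorphic_on UNIV"
      using 2 by (intro holomorphic_intros holomorphic_pcf_series) auto
    moreover have "(-1::complex) islimpt {\<mu>. Re \<mu> < 0}"
      by (rule interior_limit_point) (simp add: interior_open open_halfspace_Re_lt)
    moreover have "D \<mu> z - pcf_series \<mu> z = 0" if "\<mu> \<in> {\<mu>. Re \<mu> < 0}" for \<mu>
    proof -
      have "Gamma (- \<mu>) \<noteq> 0"
        using that by (simp add: Gamma_eq_zero_iff not_nonpos_Int_complexI)
      then show ?thesis
        using that 2 integral_unique[OF has_integral_weber[of \<mu> z]] by (simp add: pcf_series_def)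
    qed
    ultimately have "D \<nu> z - pcf_series \<nu> z = 0"
      by (rule analytic_continuation[OF _ open_UNIV connected_UNIV subset_UNIV UNIV_I _ _ UNIV_I])
    then show ?thesis
      by simp
  qed
  then show ?case
    by blast
qed

section \<open>Hermite's and Weber's differential equations\<close>

definition hermite_series :: "complex \<Rightarrow> complex \<Rightarrow> complex" where
  "hermite_series \<nu> z = (\<Sum>n. pcf_coeff \<nu> n * z ^ n)"

definition hermite_series' :: "complex \<Rightarrow> complex \<Rightarrow> complex" where
  "hermite_series' \<nu> z = (\<Sum>n. diffs (pcf_coeff \<nu>) n * z ^ n)"

lemma hermite_series_deriv:
  "(hermite_series \<nu> has_field_derivative hermite_series' \<nu> z) (at z)"
  unfolding hermite_series_def hermite_series'_def
  by (rule termdiffs_strong_converges_everywhere) (rule summable_pcf_coeff)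

lemma summable_diffs_pcf_coeff: "summable (\<lambda>n. diffs (pcf_coeff \<nu>) n * z ^ n)"
  using summable_pcf_coeff by (intro termdiff_converges_all)

text \<open>Hermite's equation y'' = z y' - nu y. Comparing coefficients of z^n gives (n + 1) (n +
  2) c(n + 2) = (n - nu) c(n), which is the recurrence of \<open>pcf_coeff\<close>.\<close>

lemma hermite_series'_deriv:
  "(hermite_series' \<nu> has_field_derivative z * hermite_series' \<nu> z - \<nu> * hermite_series \<nu> z) (at z)"
proof -
  let ?c = "pcf_coeff \<nu>"
  have "(\<lambda>n. of_nat n * ?c n * z ^ n) sums (z * hermite_series' \<nu> z)"
  proof -
    have "(\<lambda>n. z * (diffs ?c n * z ^ n)) sums (z * hermite_series' \<nu> z)"
      unfolding hermite_series'_def by (intro sums_mult summable_sums summable_diffs_pcf_coeff)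
    then have "(\<lambda>n. of_nat (Suc n) * ?c (Suc n) * z ^ Suc n) sums (z * hermite_series' \<nu> z)"
      by (simp add: diffs_def mult_ac)
    then show ?thesis
      \<comment> \<open>The shifted series may start at n = 0 because the factor n makes that term
        vanish.\<close>
      using sums_Suc_iff[of "\<lambda>n. of_nat n * ?c n * z ^ n"] by simp
  qed
  moreover have "(\<lambda>n. \<nu> * (?c n * z ^ n)) sums (\<nu> * hermite_series \<nu> z)"
    unfolding hermite_series_def by (intro sums_mult summable_sums summable_pcf_coeff)
  ultimately have "(\<lambda>n. of_nat n * ?c n * z ^ n - \<nu> * (?c n * z ^ n)) sums
      (z * hermite_series' \<nu> z - \<nu> * hermite_series \<nu> z)"
    by (rule sums_diff)
  moreover have "of_nat n * ?c n * z ^ n - \<nu> * (?c n * z ^ n) = diffs (diffs ?c) n * z ^ n" for n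
  proof -
    have "(of_nat (n + 1) * of_nat (n + 2) :: complex) \<noteq> 0"
      unfolding of_nat_mult[symmetric] of_nat_eq_0_iff by simp
    then have eq: "diffs (diffs ?c) n = (of_nat n - \<nu>) * ?c n"
      by (simp add: diffs_def field_simps del: of_nat_Suc)
    show ?thesis
      unfolding eq by (simp add: algebra_simps)
  qed
  ultimately have "(\<Sum>n. diffs (diffs ?c) n * z ^ n) = z * hermite_series' \<nu> z - \<nu> * hermite_series \<nu> z"
    by (simp add: sums_iff)
  moreover have "(hermite_series' \<nu> has_field_derivative (\<Sum>n. diffs (diffs ?c) n * z ^ n)) (at z)"
    unfolding hermite_series'_def
    by (rule termdiffs_strong_converges_everywhere) (rule summable_diffs_pcf_coeff)
  ultimately show ?thesis
    by simp
qed

definition pcf' :: "complex \<Rightarrow> complex \<Rightarrow> complex" where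
  "pcf' \<nu> z = exp (- z\<^sup>2 / 4) * (hermite_series' \<nu> z - z / 2 * hermite_series \<nu> z)"

lemma pcf_altdef: "pcf \<nu> z = exp (- z\<^sup>2 / 4) * hermite_series \<nu> z"
  by (simp add: pcf_eq_pcf_series pcf_series_def hermite_series_def)

lemma pcf_deriv: "(pcf \<nu> has_field_derivative pcf' \<nu> z) (at z)"
  unfolding pcf_altdef[abs_def] pcf'_def
  by (auto intro!: derivative_eq_intros hermite_series_deriv simp: algebra_simps)

text \<open>The factor exp (-z^2/4) removes the first-order term of Hermite's equation.\<close>

lemma weber_equation: "(pcf' \<nu> has_field_derivative (z\<^sup>2 / 4 - \<nu> - 1/2) * pcf \<nu> z) (at z)"
  unfolding pcf_altdef pcf'_def[abs_def]
  by (auto intro!: derivative_eq_intros hermite_series_deriv hermite_series'_deriv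
      simp: field_simps power2_eq_square)

lemma pcf_0: "pcf \<nu> 0 = of_real (sqrt pi) * 2 powr (\<nu> / 2) * rGamma ((1 - \<nu>) / 2)"
  by (simp add: pcf_altdef hermite_series_def powser_zero)

lemma pcf'_0: "pcf' \<nu> 0 = - of_real (sqrt pi) * 2 powr ((\<nu> + 1) / 2) * rGamma (- \<nu> / 2)"
  by (simp add: pcf'_def hermite_series'_def powser_zero diffs_def)

section \<open>The argument of a quotient of Gamma functions\<close>

definition gamma_ratio :: "real \<Rightarrow> real \<Rightarrow> complex" where
  "gamma_ratio b x = Gamma (Complex (x + 1/2) b) / Gamma (Complex x b)"

text \<open>For b > 0 this is the argument of (t + i b) / (t + 1/2 + i b), one factor of the product
  for \<open>gamma_ratio\<close>.\<close>

definition phase_step :: "real \<Rightarrow> real \<Rightarrow> real" where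
  "phase_step b t = arctan ((t + 1/2) / b) - arctan (t / b)"

text \<open>A branch of the argument given as a real series instead of through \<open>Arg\<close>,
  so that bounds and monotonicity can be read off the terms.\<close>

definition gamma_phase :: "real \<Rightarrow> real \<Rightarrow> real" where
  "gamma_phase b x = (\<Sum>k. phase_step b (x + real k))"

lemma phase_step_pos: "b > 0 \<Longrightarrow> phase_step b t > 0"
  by (simp add: phase_step_def arctan_less_iff divide_strict_right_mono)

text \<open>Each term covers only the first half of the step from x + k to x + k + 1; adding the
  increments of arctan over the second halves makes the sum telescope.\<close>

lemma sum_phase_step_le:
  assumes "b > 0"
  shows "(\<Sum>k<n. phase_step b (x + real k)) \<le> arctan ((x + real n) / b) - arctan (x / b)"
proof (induction n)
  case (Suc n)
  have "arctan ((x + real n + 1/2) / b) \<le> arctan ((x + real (Suc n)) / b)"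
    using assms by (simp add: arctan_le_iff divide_right_mono)
  then show ?case
    using Suc by (simp add: phase_step_def)
qed simp

lemma summable_phase_step:
  assumes "b > 0"
  shows "summable (\<lambda>k. phase_step b (x + real k))"
proof (rule summableI_nonneg_bounded)
  show "0 \<le> phase_step b (x + real k)" for k
    using phase_step_pos[OF assms] less_imp_le by blast
  show "(\<Sum>k<n. phase_step b (x + real k)) \<le> pi / 2 - arctan (x / b)" for n
    using sum_phase_step_le[OF assms, of x n] arctan_ubound[of "(x + real n) / b"] by linarith
qed

lemma gamma_phase_pos: "b > 0 \<Longrightarrow> gamma_phase b x > 0"
  unfolding gamma_phase_def by (intro suminf_pos summable_phase_step phase_step_pos)

lemma gamma_phase_less_pi:
  assumes "b > 0"
  shows "gamma_phase b x < pi"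
proof -
  have "gamma_phase b x \<le> pi / 2 - arctan (x / b)"
    unfolding gamma_phase_def
  proof (rule suminf_le_const[OF summable_phase_step[OF assms]])
    show "(\<Sum>k<n. phase_step b (x + real k)) \<le> pi / 2 - arctan (x / b)" for n
      using sum_phase_step_le[OF assms, of x n] arctan_ubound[of "(x + real n) / b"] by linarith
  qed
  then show ?thesis
    using arctan_lbound[of "x / b"] by linarith
qed

text \<open>The derivative of arctan decreases with the square of its argument, and u^2 < (u +
  1/2)^2 holds exactly for u > -1/4. This is where the bound -1/4 comes from.\<close>

lemma phase_step_strict_antimono:
  assumes "b > 0" "- 1/4 \<le> t" "t < t'"
  shows "phase_step b t' < phase_step b t"
proof (rule DERIV_neg_imp_decreasing_open[OF \<open>t < t'\<close>])
  fix u assume u: "t < u" "u < t'"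
  have "(phase_step b has_real_derivative
      inverse (1 + ((u + 1/2) / b)\<^sup>2) / b - inverse (1 + (u / b)\<^sup>2) / b) (at u)"
    unfolding phase_step_def[abs_def] using \<open>b > 0\<close>
    by (auto intro!: derivative_eq_intros)
  moreover have "(u / b)\<^sup>2 < ((u + 1/2) / b)\<^sup>2"
  proof -
    have "u\<^sup>2 < (u + 1/2)\<^sup>2"
      using u assms by (simp add: power2_eq_square algebra_simps)
    then show ?thesis
      using \<open>b > 0\<close> by (simp add: power_divide divide_strict_right_mono)
  qed
  then have "inverse (1 + ((u + 1/2) / b)\<^sup>2) < inverse (1 + (u / b)\<^sup>2)"
    by (intro less_imp_inverse_less) (auto intro: add_pos_nonneg)
  then have "inverse (1 + ((u + 1/2) / b)\<^sup>2) / b - inverse (1 + (u / b)\<^sup>2) / b < 0"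
    using \<open>b > 0\<close> by (simp add: divide_strict_right_mono)
  ultimately show "\<exists>y. (phase_step b has_real_derivative y) (at u) \<and> y < 0"
    by blast
next
  show "continuous_on {t..t'} (phase_step b)"
    unfolding phase_step_def[abs_def] using \<open>b > 0\<close> by (intro continuous_intros) auto
qed

lemma gamma_phase_strict_antimono:
  assumes "b > 0" "- 1/4 \<le> x" "x < y"
  shows "gamma_phase b y < gamma_phase b x"
proof -
  have "0 < (\<Sum>k. phase_step b (x + real k) - phase_step b (y + real k))"
    using assms by (intro suminf_pos summable_diff summable_phase_step)
      (auto intro!: phase_step_strict_antimono)
  also have "\<dots> = gamma_phase b x - gamma_phase b y"
    unfolding gamma_phase_def using assms by (intro suminf_diff[symmetric] summable_phase_step)
  finally show ?thesis
    by simp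
qed

section \<open>The polar form of the Gamma quotient\<close>

text \<open>In the upper half-plane pi/2 - arctan (t/b) gives the argument for every sign of t,
  without a case distinction.\<close>

lemma Complex_polar_arctan:
  assumes "b > 0"
  shows "Complex t b = of_real (norm (Complex t b)) * cis (pi / 2 - arctan (t / b))"
proof -
  have "norm (Complex t b) = b * sqrt (1 + (t / b)\<^sup>2)"
  proof -
    have "t\<^sup>2 + b\<^sup>2 = b\<^sup>2 * (1 + (t / b)\<^sup>2)"
      using assms by (simp add: field_simps power_divide)
    then show ?thesis
      using assms by (simp add: cmod_def real_sqrt_mult)
  qed
  moreover have "sqrt (1 + (t / b)\<^sup>2) > 0"
    by (simp add: add_pos_nonneg)
  ultimately show ?thesis
    using assms by (simp add: complex_eq_iff cos_diff sin_diff cos_arctan sin_arctan)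
qed

lemma Complex_quotient_polar:
  assumes "b > 0"
  shows "Complex t b / Complex (t + 1/2) b =
    of_real (norm (Complex t b) / norm (Complex (t + 1/2) b)) * cis (phase_step b t)"
proof -
  have "Complex t b / Complex (t + 1/2) b =
      of_real (norm (Complex t b)) * cis (pi / 2 - arctan (t / b)) /
      (of_real (norm (Complex (t + 1/2) b)) * cis (pi / 2 - arctan ((t + 1/2) / b)))"
    using Complex_polar_arctan[OF assms, of t] Complex_polar_arctan[OF assms, of "t + 1/2"] by simp
  also have "\<dots> = of_real (norm (Complex t b) / norm (Complex (t + 1/2) b)) *
      (cis (pi / 2 - arctan (t / b)) / cis (pi / 2 - arctan ((t + 1/2) / b)))"
    by simp
  also have "cis (pi / 2 - arctan (t / b)) / cis (pi / 2 - arctan ((t + 1/2) / b)) = cis (phase_step b t)"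
    unfolding cis_divide phase_step_def by (simp add: algebra_simps)
  finally show ?thesis .
qed

lemma prod_cis: "(\<Prod>k\<in>A. cis (f k)) = cis (\<Sum>k\<in>A. f k)"
  by (induction A rule: infinite_finite_induct) (auto simp: cis_mult)

text \<open>In the quotient of the two limit products for Gamma, the pochhammer symbols split into
  factors of known argument. Norms and finite phase sums converge separately, and uniqueness of
  limits gives the polar form.\<close>

lemma gamma_ratio_polar:
  assumes "b > 0"
  shows "gamma_ratio b x = of_real (norm (gamma_ratio b x)) * cis (gamma_phase b x)"
proof -
  let ?z = "Complex x b" and ?z' = "Complex (x + 1/2) b"
  define G where "G n = Gamma_series ?z' n / Gamma_series ?z n" for n
  have "G \<longlonglongrightarrow> gamma_ratio b x"
    unfolding G_def gamma_ratio_def using assms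
    by (intro tendsto_divide Gamma_series_LIMSEQ) (simp add: Gamma_eq_zero_iff not_nonpos_Int_complexI)
  moreover have polar: "G n = of_real (norm (G n)) * cis (\<Sum>k<Suc n. phase_step b (x + real k))" for n
  proof -
    have shift: "?z + of_nat k = Complex (x + real k) b" "?z' + of_nat k = Complex (x + real k + 1/2) b" for k
      by (simp_all add: complex_eq_iff)
    \<comment> \<open>The exponents differ by the real number 1/2, so the exponentials contribute
      only a positive factor to \<open>G n\<close>.\<close>
    have "?z' * of_real (ln (real n)) = ?z * of_real (ln (real n)) + of_real (ln (real n) / 2)"
      by (simp add: complex_eq_iff algebra_simps)
    then have "exp (?z' * of_real (ln (real n))) = exp (?z * of_real (ln (real n))) * of_real (exp (ln (real n) / 2))"
      by (simp only: exp_add exp_of_real)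
    then have "G n = of_real (exp (ln (real n) / 2)) * (pochhammer ?z (Suc n) / pochhammer ?z' (Suc n))"
      by (simp add: G_def Gamma_series_def)
    also have "pochhammer ?z (Suc n) / pochhammer ?z' (Suc n) =
        (\<Prod>k<Suc n. Complex (x + real k) b / Complex (x + real k + 1/2) b)"
      unfolding pochhammer_prod prod_dividef[symmetric] atLeast0LessThan
      by (intro prod.cong refl) (simp only: shift)
    also have "\<dots> = (\<Prod>k<Suc n. of_real (norm (Complex (x + real k) b) / norm (Complex (x + real k + 1/2) b)) *
        cis (phase_step b (x + real k)))"
      by (intro prod.cong refl Complex_quotient_polar assms)
    also have "\<dots> = of_real (\<Prod>k<Suc n. norm (Complex (x + real k) b) / norm (Complex (x + real k + 1/2) b)) *
        cis (\<Sum>k<Suc n. phase_step b (x + real k))"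
      unfolding prod.distrib of_real_prod by (simp only: prod_cis)
    finally have G: "G n = of_real (exp (ln (real n) / 2) *
        (\<Prod>k<Suc n. norm (Complex (x + real k) b) / norm (Complex (x + real k + 1/2) b))) *
        cis (\<Sum>k<Suc n. phase_step b (x + real k))"
      (is "_ = of_real ?\<rho> * _")
      by (simp only: of_real_mult mult.assoc)
    have "?\<rho> \<ge> 0"
      by (intro mult_nonneg_nonneg prod_nonneg) auto
    then have "norm (G n) = ?\<rho>"
      unfolding G by (simp only: norm_mult norm_of_real norm_cis mult_1_right abs_of_nonneg)
    with G show ?thesis
      by metis
  qed
  moreover have "(\<lambda>n. \<Sum>k<Suc n. phase_step b (x + real k)) \<longlonglongrightarrow> gamma_phase b x"
    unfolding gamma_phase_def using summable_LIMSEQ[OF summable_phase_step[OF assms]] by (rule LIMSEQ_Suc)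
  ultimately have "(\<lambda>n. of_real (norm (G n)) * cis (\<Sum>k<Suc n. phase_step b (x + real k)))
      \<longlonglongrightarrow> of_real (norm (gamma_ratio b x)) * cis (gamma_phase b x)"
    unfolding cis_conv_exp by (intro tendsto_intros)
  then have "G \<longlonglongrightarrow> of_real (norm (gamma_ratio b x)) * cis (gamma_phase b x)"
    by (simp only: polar[symmetric])
  with \<open>G \<longlonglongrightarrow> gamma_ratio b x\<close> show ?thesis
    by (rule LIMSEQ_unique)
qed

section \<open>Comparison of the phase with pi/4\<close>

lemma gamma_ratio_nonzero: "b \<noteq> 0 \<Longrightarrow> gamma_ratio b x \<noteq> 0"
  by (simp add: gamma_ratio_def Gamma_eq_zero_iff not_nonpos_Int_complexI)

text \<open>By reflection, gamma_ratio b (1/4) is a positive multiple of sin (pi (1/4 + i b)).\<close>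
lemma gamma_ratio_quarter:
  assumes "b > 0"
  shows "0 < Im (gamma_ratio b (1/4))" "Im (gamma_ratio b (1/4)) < Re (gamma_ratio b (1/4))"
proof -
  define w where "w = Gamma (Complex (3/4) b)"
  define c where "c = (norm w)\<^sup>2 / pi"
  define s where "s = sin (of_real pi * Complex (1/4) b)"
  have "w \<noteq> 0" "Gamma (Complex (1/4) b) \<noteq> 0"
    using assms by (simp_all add: w_def Gamma_eq_zero_iff not_nonpos_Int_complexI)
  have Re_s: "Re s = sqrt 2 / 2 * (exp (pi * b) + exp (- pi * b)) / 2"
    and Im_s: "Im s = sqrt 2 / 2 * (exp (pi * b) - exp (- pi * b)) / 2"
    using sin_45 cos_45 by (simp_all add: s_def Re_sin Im_sin)
  \<comment> \<open>So the reflection formula pairs Gamma (1/4 + i b) with the conjugate of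
    \<open>w\<close>.\<close>
  have "1 - Complex (1/4) b = cnj (Complex (3/4) b)"
    by (simp add: complex_eq_iff)
  then have "Gamma (Complex (1/4) b) * cnj w = of_real pi / s"
    unfolding w_def s_def cnj_Gamma using Gamma_reflection_complex[of "Complex (1/4) b"] by simp
  moreover have "gamma_ratio b (1/4) = w * cnj w / (Gamma (Complex (1/4) b) * cnj w)"
    using \<open>w \<noteq> 0\<close> by (simp add: gamma_ratio_def w_def)
  moreover have "of_real c = w * cnj w / of_real pi"
    by (simp only: c_def of_real_divide complex_norm_square)
  ultimately have "gamma_ratio b (1/4) = of_real c * s"
    by simp
  moreover have "c > 0"
    using \<open>w \<noteq> 0\<close> by (simp add: c_def)
  \<comment> \<open>Re s - Im s equals sqrt 2 / 2 * exp (-pi b).\<close>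
  moreover have "0 < Im s" "Im s < Re s"
    unfolding Re_s Im_s using assms by (simp_all add: field_simps)
  ultimately show "0 < Im (gamma_ratio b (1/4))" "Im (gamma_ratio b (1/4)) < Re (gamma_ratio b (1/4))"
    by simp_all
qed

text \<open>The functional equation gives gamma_ratio b (-1/4) = (-1/4 + i b) / gamma_ratio b (1/4).\<close>
lemma gamma_ratio_minus_quarter:
  assumes "b > 0"
  shows "Re (gamma_ratio b (- 1/4)) < Im (gamma_ratio b (- 1/4))"
proof -
  let ?c = "Complex (- 1/4) b" and ?R = "gamma_ratio b (1/4)"
  have "?c + 1 = Complex (3/4) b"
    by (simp add: complex_eq_iff)
  then have "Gamma (Complex (3/4) b) = ?c * Gamma ?c"
    using Gamma_plus1[of ?c] assms by (simp add: not_nonpos_Int_complexI)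
  moreover have "?c \<noteq> 0"
    using assms by (simp add: complex_eq_iff)
  moreover have "Gamma ?c \<noteq> 0" "Gamma (Complex (3/4) b) \<noteq> 0"
    using assms by (simp_all add: Gamma_eq_zero_iff not_nonpos_Int_complexI)
  ultimately have "gamma_ratio b (- 1/4) = ?c / ?R"
    by (simp add: gamma_ratio_def field_simps)
  also have "\<dots> = ?c * cnj ?R / of_real ((norm ?R)\<^sup>2)"
    by (rule complex_div_cnj)
  finally have eq: "gamma_ratio b (- 1/4) = ?c * cnj ?R / of_real ((norm ?R)\<^sup>2)" .
  have "0 < (norm ?R)\<^sup>2"
    using gamma_ratio_nonzero[of b] assms by simp
  \<comment> \<open>With \<open>?R\<close> = u + i v, the imaginary part exceeds the real part by (u
    + v)/4 + b (u - v), which is positive because 0 < v < u.\<close>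
  moreover have "Re (?c * cnj ?R) < Im (?c * cnj ?R)"
  proof -
    have "b * Im ?R < b * Re ?R"
      using gamma_ratio_quarter[OF assms] assms by simp
    then show ?thesis
      using gamma_ratio_quarter[OF assms] by simp
  qed
  ultimately show ?thesis
    unfolding eq Re_divide_of_real Im_divide_of_real by (rule divide_strict_right_mono[rotated])
qed

text \<open>Equal real and imaginary parts fix the phase modulo pi. Since the phase lies in (0, pi),
  its difference from pi/4 lies in (-pi, pi), where only 0 is a zero of sine.\<close>

lemma gamma_phase_eq_quarter_pi_iff:
  assumes "b > 0"
  shows "gamma_phase b x = pi / 4 \<longleftrightarrow> Im (gamma_ratio b x) = Re (gamma_ratio b x)"
proof -
  let ?\<theta> = "gamma_phase b x" and ?r = "norm (gamma_ratio b x)"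
  have r: "?r > 0"
    using gamma_ratio_nonzero[of b] assms by simp
  have "Re (gamma_ratio b x) = ?r * cos ?\<theta>" "Im (gamma_ratio b x) = ?r * sin ?\<theta>"
    using arg_cong[OF gamma_ratio_polar[OF assms, of x], of Re]
      arg_cong[OF gamma_ratio_polar[OF assms, of x], of Im] by simp_all
  then have "Im (gamma_ratio b x) = Re (gamma_ratio b x) \<longleftrightarrow> sin ?\<theta> = cos ?\<theta>"
    using r by simp
  also have "\<dots> \<longleftrightarrow> sin (?\<theta> - pi / 4) = 0"
    by (simp add: sin_diff cos_45 sin_45)
  also have "\<dots> \<longleftrightarrow> ?\<theta> - pi / 4 = 0"
  proof
    assume "sin (?\<theta> - pi / 4) = 0"
    moreover have "- pi < ?\<theta> - pi / 4" "?\<theta> - pi / 4 < pi"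
      using gamma_phase_pos[OF assms, of x] gamma_phase_less_pi[OF assms, of x] pi_gt_zero by linarith+
    ultimately show "?\<theta> - pi / 4 = 0"
      using sin_eq_0_pi by blast
  qed (simp only: sin_zero)
  finally show ?thesis
    by simp
qed

text \<open>The intermediate value theorem is applied to Re - Im of \<open>gamma_ratio\<close>,
  whose continuity follows from that of Gamma off the real axis; no continuity of the series
  \<open>gamma_phase\<close> has to be shown.\<close>

lemma ex_gamma_phase_eq_quarter_pi:
  assumes "b > 0"
  shows "\<exists>x\<in>{- 1/4<..<1/4}. gamma_phase b x = pi / 4"
proof -
  let ?f = "\<lambda>x. Re (gamma_ratio b x) - Im (gamma_ratio b x)"
  have "continuous_on {- 1/4..1/4} (\<lambda>x. Gamma (Complex (x + a) b))" for a
  proof (rule continuous_on_compose2[OF continuous_on_Gamma])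
    show "continuous_on {- 1/4..1/4} (\<lambda>x. Complex (x + a) b)"
      unfolding Complex_eq by (intro continuous_intros)
    show "{s. Im s \<noteq> 0} \<inter> \<int>\<^sub>\<le>\<^sub>0 = {}"
      using not_nonpos_Int_complexI by auto
  qed (use assms in auto)
  from this[of 0] this[of "1/2"] have "continuous_on {- 1/4..1/4} ?f"
    unfolding gamma_ratio_def using assms
    by (intro continuous_intros) (auto simp: not_nonpos_Int_complexI Gamma_eq_zero_iff)
  moreover have neg: "?f (- 1/4) < 0" and pos: "?f (1/4) > 0"
    using gamma_ratio_quarter[OF assms] gamma_ratio_minus_quarter[OF assms] by simp_all
  ultimately obtain x where x: "- 1/4 \<le> x" "x \<le> 1/4" "?f x = 0"
    using IVT'[of ?f "- 1/4" 0 "1/4"] by auto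
  have "x \<noteq> - 1/4" "x \<noteq> 1/4"
    using x(3) neg pos by force+
  with x show ?thesis
    using gamma_phase_eq_quarter_pi_iff[OF assms, of x] by (intro bexI[of _ x]) auto
qed

section \<open>The argument of A(lambda)\<close>

text \<open>Gamma commutes with conjugation. This reduces \<kappa> = -1 to positive b with the
  opposite phase.\<close>

lemma gamma_ratio_minus: "gamma_ratio (- b) x = cnj (gamma_ratio b x)"
proof -
  have "Complex u (- b) = cnj (Complex u b)" for u
    by (simp add: complex_eq_iff)
  then show ?thesis
    by (simp only: gamma_ratio_def cnj_Gamma complex_cnj_divide)
qed

text \<open>Here -i lambda/2 = -\<sigma>/2 + i \<kappa>/(2 h).\<close>

lemma Acoef_eq_gamma_ratio:
  "Acoef (lam_of h \<kappa> \<sigma>) = of_real (sqrt 2) * cis (- pi / 4) * gamma_ratio (\<kappa> / (2 * h)) (1/4 - \<sigma> / 2)"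
proof -
  have "3/4 - \<i> * lam_of h \<kappa> \<sigma> / 2 = Complex (1/4 - \<sigma> / 2 + 1/2) (\<kappa> / (2 * h))"
    "1/4 - \<i> * lam_of h \<kappa> \<sigma> / 2 = Complex (1/4 - \<sigma> / 2) (\<kappa> / (2 * h))"
    by (simp_all add: complex_eq_iff lam_of_def)
  then show ?thesis
    by (simp add: Acoef_def gamma_ratio_def cis_conv_exp)
qed

text \<open>A(lambda) has argument \<open>gamma_phase\<close> - pi/4, which lies in (-pi/4, 3 pi/4);
  in that range the only real direction is the positive one.\<close>

lemma Acoef_positive_iff:
  assumes "h > 0"
  shows "Acoef (lam_of h 1 \<sigma>) \<in> \<real> \<and> 0 < Re (Acoef (lam_of h 1 \<sigma>)) \<longleftrightarrow>
    gamma_phase (1 / (2 * h)) (1/4 - \<sigma> / 2) = pi / 4"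
proof -
  let ?b = "1 / (2 * h)" and ?x = "1/4 - \<sigma> / 2"
  let ?\<theta> = "gamma_phase ?b ?x" and ?r = "norm (gamma_ratio ?b ?x)"
  have b: "?b > 0"
    using assms by simp
  have r: "?r > 0"
    using gamma_ratio_nonzero[of ?b] b by simp
  have "Acoef (lam_of h 1 \<sigma>) = of_real (sqrt 2) * cis (- pi / 4) * (of_real ?r * cis ?\<theta>)"
    unfolding Acoef_eq_gamma_ratio by (subst gamma_ratio_polar[OF b]) (rule refl)
  also have "\<dots> = of_real (sqrt 2 * ?r) * cis (?\<theta> - pi / 4)"
    by (simp add: mult_ac cis_mult)
  finally have A: "Acoef (lam_of h 1 \<sigma>) = of_real (sqrt 2 * ?r) * cis (?\<theta> - pi / 4)" .
  show ?thesis
  proof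
    assume "Acoef (lam_of h 1 \<sigma>) \<in> \<real> \<and> 0 < Re (Acoef (lam_of h 1 \<sigma>))"
    then have "sin (?\<theta> - pi / 4) = 0"
      unfolding A using r by (auto simp: complex_is_Real_iff)
    then show "?\<theta> = pi / 4"
      using gamma_phase_pos[OF b, of ?x] gamma_phase_less_pi[OF b, of ?x]
        sin_eq_0_pi[of "?\<theta> - pi / 4"] by simp
  next
    assume "?\<theta> = pi / 4"
    then have "?\<theta> - pi / 4 = 0"
      by simp
    then show "Acoef (lam_of h 1 \<sigma>) \<in> \<real> \<and> 0 < Re (Acoef (lam_of h 1 \<sigma>))"
      unfolding A using r by (simp only: cis_zero mult_1_right Reals_of_real Re_complex_of_real) simp
  qed
qed

text \<open>The argument is now -(\<open>gamma_phase\<close> + pi/4), strictly between -5 pi/4 and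
  -pi/4. The only real direction there is -pi, which makes A(lambda) negative.\<close>

lemma Acoef_not_positive:
  assumes "h > 0"
  shows "\<not> (Acoef (lam_of h (- 1) \<sigma>) \<in> \<real> \<and> 0 < Re (Acoef (lam_of h (- 1) \<sigma>)))"
proof
  let ?b = "1 / (2 * h)" and ?x = "1/4 - \<sigma> / 2"
  let ?\<theta> = "gamma_phase ?b ?x" and ?r = "norm (gamma_ratio ?b ?x)"
  assume asm: "Acoef (lam_of h (- 1) \<sigma>) \<in> \<real> \<and> 0 < Re (Acoef (lam_of h (- 1) \<sigma>))"
  have b: "?b > 0"
    using assms by simp
  have r: "?r > 0"
    using gamma_ratio_nonzero[of ?b] b by simp
  have "Acoef (lam_of h (- 1) \<sigma>) = of_real (sqrt 2) * cis (- pi / 4) * cnj (gamma_ratio ?b ?x)"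
    unfolding Acoef_eq_gamma_ratio using gamma_ratio_minus[of ?b ?x] by simp
  also have "cnj (gamma_ratio ?b ?x) = of_real ?r * cis (- ?\<theta>)"
    by (subst gamma_ratio_polar[OF b]) (simp add: cis_cnj)
  also have "of_real (sqrt 2) * cis (- pi / 4) * (of_real ?r * cis (- ?\<theta>)) =
      of_real (sqrt 2 * ?r) * (cis (- pi / 4) * cis (- ?\<theta>))"
    by (simp add: mult_ac)
  also have "cis (- pi / 4) * cis (- ?\<theta>) = cis (- (?\<theta> + pi / 4))"
    unfolding cis_mult by (simp add: add.commute)
  finally have A: "Acoef (lam_of h (- 1) \<sigma>) = of_real (sqrt 2 * ?r) * cis (- (?\<theta> + pi / 4))" .
  have sin: "sin (?\<theta> + pi / 4) = 0" and cos: "cos (?\<theta> + pi / 4) > 0"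
    using asm r unfolding A complex_is_Real_iff by (auto simp: zero_less_mult_iff mult_less_0_iff simp del: minus_add_distrib)
  have bounds: "0 < ?\<theta>" "?\<theta> < pi"
    using gamma_phase_pos[OF b] gamma_phase_less_pi[OF b] by auto
  then have "- pi < ?\<theta> + pi / 4 - pi" "?\<theta> + pi / 4 - pi < pi"
    using pi_gt_zero by linarith+
  moreover have "sin (?\<theta> + pi / 4 - pi) = 0"
    unfolding sin_diff[of "?\<theta> + pi / 4" pi] using sin by simp
  ultimately have "?\<theta> + pi / 4 - pi = 0"
    using sin_eq_0_pi by blast
  then have "?\<theta> + pi / 4 = pi"
    by simp
  with cos show False
    by simp
qed

section \<open>Outgoing solutions\<close>

definition wscale :: "real \<Rightarrow> complex" where
  "wscale h = exp (- \<i> * of_real pi / 4) * of_real (sqrt h)"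

definition wfun' :: "real \<Rightarrow> complex \<Rightarrow> real \<Rightarrow> complex" where
  "wfun' h lam x = wscale h * pcf' (\<i> * lam - 1/2) (wscale h * of_real x)"

lemma wfun_altdef: "wfun h lam x = pcf (\<i> * lam - 1/2) (wscale h * of_real x)"
  by (simp add: wfun_def wscale_def)

lemma wscale_power2:
  assumes "h \<ge> 0"
  shows "(wscale h)\<^sup>2 = - \<i> * of_real h"
proof -
  have "(exp (- \<i> * of_real pi / 4))\<^sup>2 = cis (- (pi / 2))"
    by (simp add: power2_eq_square cis_conv_exp flip: exp_add)
  also have "\<dots> = - \<i>"
    by (simp add: complex_eq_iff)
  finally show ?thesis
    using assms by (simp add: wscale_def power_mult_distrib flip: of_real_power)
qed

lemma wfun_has_vector_derivative: "(wfun h lam has_vector_derivative wfun' h lam x) (at x within S)"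
proof -
  have "((\<lambda>x. wscale h * of_real x) has_vector_derivative wscale h) (at x within S)"
    by (auto intro!: derivative_eq_intros)
  from field_vector_diff_chain_within[OF this has_field_derivative_at_within[OF pcf_deriv]]
  show ?thesis
    by (simp add: wfun_altdef[abs_def] wfun'_def o_def)
qed

text \<open>Weber's equation with nu + 1/2 = i lambda and argument c x, where c^2 = -i h: the chain
  rule factor c^2 turns the potential c^2 x^2/4 into -h^2 x^2/4 and -i lambda into -h
  lambda.\<close>

lemma wfun'_has_vector_derivative:
  assumes "h \<ge> 0"
  shows "(wfun' h lam has_vector_derivative
    (- of_real (h\<^sup>2 * x\<^sup>2 / 4) - of_real h * lam) * wfun h lam x) (at x within S)"
proof -
  let ?c = "wscale h" and ?\<nu> = "\<i> * lam - 1/2"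
  have "((\<lambda>x. ?c * of_real x) has_vector_derivative ?c) (at x within S)"
    by (auto intro!: derivative_eq_intros)
  from has_vector_derivative_mult_right[OF field_vector_diff_chain_within[OF this has_field_derivative_at_within[OF weber_equation]], of ?c ?\<nu>]
  have deriv: "(wfun' h lam has_vector_derivative ?c * (?c * (((?c * of_real x)\<^sup>2 / 4 - ?\<nu> - 1/2) * wfun h lam x))) (at x within S)"
    by (simp add: wfun_altdef wfun'_def[abs_def] o_def)
  have eq1: "?c * (?c * (((?c * of_real x)\<^sup>2 / 4 - ?\<nu> - 1/2) * wfun h lam x)) =
      ?c\<^sup>2 * (?c\<^sup>2 * (of_real x)\<^sup>2 / 4 - \<i> * lam) * wfun h lam x"
    by (simp add: power2_eq_square mult_ac)
  have eq2: "?c\<^sup>2 * (?c\<^sup>2 * (of_real x)\<^sup>2 / 4 - \<i> * lam) = - of_real (h\<^sup>2 * x\<^sup>2 / 4) - of_real h * lam"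
    unfolding wscale_power2[OF assms] by (simp add: power2_eq_square algebra_simps)
  show ?thesis
    using deriv unfolding eq1 eq2 .
qed

text \<open>The value can vanish only at a pole of Gamma (3/4 - i lambda/2), and that argument has
  imaginary part -Re lambda / 2.\<close>

lemma wfun_0_nonzero:
  assumes "Re lam \<noteq> 0"
  shows "wfun h lam 0 \<noteq> 0"
  using assms by (simp add: wfun_altdef pcf_0 rGamma_eq_zero_iff not_nonpos_Int_complexI)

text \<open>This is where A(lambda) enters: the quotient of \<open>pcf'_0\<close> by
  \<open>pcf_0\<close> is -sqrt 2 * Gamma (3/4 - i lambda/2) / Gamma (1/4 - i lambda/2), and
  \<open>wscale\<close> supplies the remaining factors.\<close>

lemma wfun'_0:
  assumes "Re lam \<noteq> 0"
  shows "wfun' h lam 0 = - of_real (sqrt h) * Acoef lam * wfun h lam 0"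
proof -
  let ?\<nu> = "\<i> * lam - 1/2"
  have eq: "(1 - ?\<nu>) / 2 = 3/4 - \<i> * lam / 2" "- ?\<nu> / 2 = 1/4 - \<i> * lam / 2"
    by (simp_all add: field_simps)
  define G1 G3 where "G1 = Gamma (1/4 - \<i> * lam / 2)" and "G3 = Gamma (3/4 - \<i> * lam / 2)"
  have "G3 \<noteq> 0"
    using assms by (simp add: G3_def Gamma_eq_zero_iff not_nonpos_Int_complexI)
  have pow: "(2::complex) powr ((?\<nu> + 1) / 2) = of_real (sqrt 2) * 2 powr (?\<nu> / 2)"
  proof -
    have "(2::complex) powr ((?\<nu> + 1) / 2) = 2 powr (1/2 + ?\<nu> / 2)"
      by (simp add: field_simps)
    also have "\<dots> = 2 powr (1/2) * 2 powr (?\<nu> / 2)"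
      by (rule powr_add)
    also have "(2::complex) powr (1/2) = csqrt (of_real 2)"
      by (simp add: csqrt_conv_powr)
    also have "\<dots> = of_real (sqrt 2)"
      by (rule of_real_sqrt[symmetric]) simp
    finally show ?thesis .
  qed
  show ?thesis
    unfolding wfun_altdef wfun'_def Acoef_def wscale_def of_real_0 mult_zero_right pcf_0 pcf'_0 pow eq
      rGamma_inverse_Gamma G1_def[symmetric] G3_def[symmetric]
    using \<open>G3 \<noteq> 0\<close> by (simp add: inverse_eq_divide mult_ac)
qed

lemma lam_of_eq:
  assumes "h \<noteq> 0"
  shows "of_real h * lam_of h \<kappa> \<sigma> = - (of_real \<kappa> + \<i> * of_real (h * \<sigma>))"
  using assms by (simp add: lam_of_def field_simps)

section \<open>Matching outgoing solutions at the origin\<close>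

text \<open>The even function \<alpha> w(|z|) has derivative jump 2 \<alpha> w'(0) = -2 sqrt h
  A(lambda) \<phi>(0). The jump condition thus asks for |\<phi>(0)|^(p-1) = 2 sqrt h A(lambda),
  which can be met when A(lambda) is positive.\<close>

lemma outgoing_exists:
  assumes "p > 1" "h > 0" "\<kappa> \<noteq> 0"
    and A: "Acoef (lam_of h \<kappa> \<sigma>) \<in> \<real>" "0 < Re (Acoef (lam_of h \<kappa> \<sigma>))"
  shows "\<exists>\<phi>. outgoing p h \<kappa> \<sigma> \<phi> \<and> \<phi> \<noteq> (\<lambda>_. 0)"
proof -
  define lam where "lam = lam_of h \<kappa> \<sigma>"
  define r where "r = Re (Acoef lam)"
  define w0 where "w0 = wfun h lam 0"
  define s where "s = 2 * sqrt h * r"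
  \<comment> \<open>Chosen so that |\<phi>(0)|^(p-1) = \<open>s\<close>.\<close>
  define \<alpha> where "\<alpha> = s powr (1 / (p - 1)) / norm w0"
  define \<phi> where "\<phi> z = of_real \<alpha> * wfun h lam \<bar>z\<bar>" for z :: real
  define \<phi>1 where "\<phi>1 z = (if z > 0 then of_real \<alpha> * wfun' h lam z else - (of_real \<alpha> * wfun' h lam (- z)))" for z :: real
  define \<phi>2 where "\<phi>2 z = of_real \<alpha> * ((- of_real (h\<^sup>2 * z\<^sup>2 / 4) - of_real h * lam) * wfun h lam \<bar>z\<bar>)" for z :: real
  have "Re lam \<noteq> 0"
    using assms by (simp add: lam_def lam_of_def)
  then have "w0 \<noteq> 0" and w'0: "wfun' h lam 0 = - of_real (sqrt h) * Acoef lam * w0"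
    by (simp_all add: w0_def wfun_0_nonzero wfun'_0)
  have Ar: "Acoef lam = of_real r" and "r > 0"
    using A by (simp_all add: r_def lam_def)
  then have "s > 0"
    using assms by (simp add: s_def)
  then have "\<alpha> > 0"
    using \<open>w0 \<noteq> 0\<close> by (simp add: \<alpha>_def)
  have \<phi>0: "\<phi> 0 = of_real \<alpha> * w0"
    by (simp add: \<phi>_def w0_def)
  have right: "((\<lambda>z. of_real \<alpha> * wfun h lam z) has_vector_derivative of_real \<alpha> * wfun' h lam z) (at z within S)"
    and right': "((\<lambda>z. of_real \<alpha> * wfun' h lam z) has_vector_derivative
        of_real \<alpha> * ((- of_real (h\<^sup>2 * z\<^sup>2 / 4) - of_real h * lam) * wfun h lam z)) (at z within S)" for z S
    using wfun_has_vector_derivative wfun'_has_vector_derivative \<open>h > 0\<close>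
    by (auto intro!: has_vector_derivative_mult_right)
  \<comment> \<open>Reflecting z to -z flips the sign of the first derivative and preserves the form
    of the equation, since its coefficient is even in z.\<close>
  have left: "((\<lambda>z. of_real \<alpha> * wfun h lam (- z)) has_vector_derivative - (of_real \<alpha> * wfun' h lam (- z))) (at z within S)"
    and left': "((\<lambda>z. - (of_real \<alpha> * wfun' h lam (- z))) has_vector_derivative
        of_real \<alpha> * ((- of_real (h\<^sup>2 * z\<^sup>2 / 4) - of_real h * lam) * wfun h lam (- z))) (at z within S)" for z S
  proof -
    have "(uminus has_vector_derivative (- 1::real)) (at z within S)"
      by (auto intro!: derivative_eq_intros)
    from vector_diff_chain_within[OF this right] has_vector_derivative_minus[OF vector_diff_chain_within[OF this right']]
    show "((\<lambda>z. of_real \<alpha> * wfun h lam (- z)) has_vector_derivative - (of_real \<alpha> * wfun' h lam (- z))) (at z within S)"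
      "((\<lambda>z. - (of_real \<alpha> * wfun' h lam (- z))) has_vector_derivative
        of_real \<alpha> * ((- of_real (h\<^sup>2 * z\<^sup>2 / 4) - of_real h * lam) * wfun h lam (- z))) (at z within S)"
      by (simp_all add: o_def)
  qed
  have ode: "(\<phi> has_vector_derivative \<phi>1 z) (at z) \<and> (\<phi>1 has_vector_derivative \<phi>2 z) (at z) \<and>
      (of_real \<kappa> + \<i> * of_real (h * \<sigma>)) * \<phi> z - \<phi>2 z - of_real (h\<^sup>2 * z\<^sup>2 / 4) * \<phi> z = 0"
    if "z \<noteq> 0" for z
  proof (intro conjI)
    have "of_real \<kappa> + \<i> * of_real (h * \<sigma>) = - (of_real h * lam)"
      using \<open>h > 0\<close> by (simp add: lam_def lam_of_eq)
    then show "(of_real \<kappa> + \<i> * of_real (h * \<sigma>)) * \<phi> z - \<phi>2 z - of_real (h\<^sup>2 * z\<^sup>2 / 4) * \<phi> z = 0"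
      unfolding \<phi>_def \<phi>2_def by (simp only:) (simp add: algebra_simps)
    show "(\<phi> has_vector_derivative \<phi>1 z) (at z)"
    proof (cases "z > 0")
      case True
      show ?thesis
        by (rule has_vector_derivative_transform_within_open[OF _ open_greaterThan[of 0]])
           (use True right in \<open>auto simp: \<phi>_def \<phi>1_def\<close>)
    next
      case False
      show ?thesis
        by (rule has_vector_derivative_transform_within_open[OF _ open_lessThan[of 0]])
           (use False that left in \<open>auto simp: \<phi>_def \<phi>1_def\<close>)
    qed
    show "(\<phi>1 has_vector_derivative \<phi>2 z) (at z)"
    proof (cases "z > 0")
      case True
      have "((\<lambda>z. of_real \<alpha> * wfun' h lam z) has_vector_derivative \<phi>2 z) (at z)"
        using right'[of z UNIV] True by (simp add: \<phi>2_def)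
      then show ?thesis
        by (rule has_vector_derivative_transform_within_open[OF _ open_greaterThan[of 0]])
           (use True in \<open>auto simp: \<phi>1_def\<close>)
    next
      case False
      have "((\<lambda>z. - (of_real \<alpha> * wfun' h lam (- z))) has_vector_derivative \<phi>2 z) (at z)"
        using left'[of z UNIV] False that by (simp add: \<phi>2_def)
      then show ?thesis
        by (rule has_vector_derivative_transform_within_open[OF _ open_lessThan[of 0]])
           (use False that in \<open>auto simp: \<phi>1_def\<close>)
    qed
  qed
  have dp: "(\<phi> has_vector_derivative of_real \<alpha> * wfun' h lam 0) (at 0 within {0..})"
    by (rule has_vector_derivative_transform[OF _ _ right]) (auto simp: \<phi>_def)
  have dm: "(\<phi> has_vector_derivative - (of_real \<alpha> * wfun' h lam 0)) (at 0 within {..0})"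
    by (rule has_vector_derivative_transform[OF _ _ left[of 0, simplified]]) (auto simp: \<phi>_def)
  have jump: "of_real \<alpha> * wfun' h lam 0 - - (of_real \<alpha> * wfun' h lam 0) =
      - of_real (norm (\<phi> 0) powr (p - 1)) * \<phi> 0"
  proof -
    have "norm (\<phi> 0) = s powr (1 / (p - 1))"
    proof -
      have "norm (\<phi> 0) = \<alpha> * norm w0"
        using \<open>\<alpha> > 0\<close> by (simp add: \<phi>0 norm_mult)
      then show ?thesis
        using \<open>w0 \<noteq> 0\<close> by (simp add: \<alpha>_def)
    qed
    then have "norm (\<phi> 0) powr (p - 1) = s"
      using \<open>s > 0\<close> assms by (simp add: powr_powr)
    then show ?thesis
      by (simp add: w'0 Ar \<phi>0 s_def)
  qed
  have cont: "continuous (at 0) \<phi>"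
  proof -
    have "continuous_on UNIV (wfun h lam)"
      unfolding continuous_on_eq_continuous_within
      using has_vector_derivative_continuous[OF wfun_has_vector_derivative] by blast
    then have "continuous_on UNIV (\<lambda>z. wfun h lam \<bar>z\<bar>)"
      by (rule continuous_on_compose2) (auto intro: continuous_intros)
    then have "isCont (\<lambda>z. wfun h lam \<bar>z\<bar>) 0"
      by (simp add: continuous_on_eq_continuous_at)
    then show ?thesis
      unfolding \<phi>_def[abs_def] by (intro continuous_intros)
  qed
  have "delta_solution p h \<kappa> \<sigma> \<phi>"
    unfolding delta_solution_def using ode cont dp dm jump by blast
  moreover have "\<exists>ap am. (\<forall>z>0. \<phi> z = ap * wfun h lam z) \<and> (\<forall>z<0. \<phi> z = am * wfun h lam (- z))"
    by (intro exI[of _ "of_real \<alpha>"]) (auto simp: \<phi>_def)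
  ultimately have "outgoing p h \<kappa> \<sigma> \<phi>"
    unfolding outgoing_def lam_def by blast
  moreover have "\<phi> 0 \<noteq> 0"
    using \<phi>0 \<open>\<alpha> > 0\<close> \<open>w0 \<noteq> 0\<close> by simp
  ultimately show ?thesis
    by auto
qed

text \<open>Continuity at 0 forces equal coefficients on both sides, as w does not vanish there. The
  jump condition then reads 2 sqrt h A(lambda) = |\<phi>(0)|^(p-1), and nontriviality makes the
  right side positive.\<close>

lemma outgoing_imp_Acoef_positive:
  assumes "h > 0" "\<kappa> \<noteq> 0" and \<phi>: "outgoing p h \<kappa> \<sigma> \<phi>" "\<phi> \<noteq> (\<lambda>_. 0)"
  shows "Acoef (lam_of h \<kappa> \<sigma>) \<in> \<real> \<and> 0 < Re (Acoef (lam_of h \<kappa> \<sigma>))"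
proof -
  define lam where "lam = lam_of h \<kappa> \<sigma>"
  define w0 where "w0 = wfun h lam 0"
  define s where "s = norm (\<phi> 0) powr (p - 1)"
  have "Re lam \<noteq> 0"
    using assms by (simp add: lam_def lam_of_def)
  then have "w0 \<noteq> 0" and w'0: "wfun' h lam 0 = - of_real (sqrt h) * Acoef lam * w0"
    by (simp_all add: w0_def wfun_0_nonzero wfun'_0)
  obtain ap am where ap: "\<And>z. z > 0 \<Longrightarrow> \<phi> z = ap * wfun h lam z"
    and am: "\<And>z. z < 0 \<Longrightarrow> \<phi> z = am * wfun h lam (- z)"
    using \<phi> unfolding outgoing_def lam_def by blast
  obtain dp dm where dp: "(\<phi> has_vector_derivative dp) (at 0 within {0..})"
    and dm: "(\<phi> has_vector_derivative dm) (at 0 within {..0})"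
    and jump: "dp - dm = - of_real s * \<phi> 0" and cont: "continuous (at 0) \<phi>"
    using \<phi> unfolding outgoing_def delta_solution_def s_def by blast
  have right: "((\<lambda>z. ap * wfun h lam z) has_vector_derivative ap * wfun' h lam 0) (at 0 within S)" for S
    by (intro has_vector_derivative_mult_right wfun_has_vector_derivative)
  have left: "((\<lambda>z. am * wfun h lam (- z)) has_vector_derivative - (am * wfun' h lam 0)) (at 0 within S)" for S
  proof -
    have "(uminus has_vector_derivative (- 1::real)) (at 0 within S)"
      by (auto intro!: derivative_eq_intros)
    from has_vector_derivative_mult_right[OF vector_diff_chain_within[OF this wfun_has_vector_derivative], of am h lam]
    show ?thesis
      by (simp add: o_def)
  qed
  have \<phi>0_ap: "\<phi> 0 = ap * w0"
  proof (rule tendsto_unique[of "at_right (0::real)"])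
    show "(\<phi> \<longlongrightarrow> \<phi> 0) (at_right 0)"
      using cont by (simp add: continuous_within filterlim_at_split)
    have "((\<lambda>z. ap * wfun h lam z) \<longlongrightarrow> ap * w0) (at_right 0)"
      using has_vector_derivative_continuous[OF right[of "{0<..}"]] by (simp add: continuous_within w0_def)
    then show "(\<phi> \<longlongrightarrow> ap * w0) (at_right 0)"
      by (rule Lim_transform_eventually) (auto simp: eventually_at_filter ap)
  qed simp
  have \<phi>0_am: "\<phi> 0 = am * w0"
  proof (rule tendsto_unique[of "at_left (0::real)"])
    show "(\<phi> \<longlongrightarrow> \<phi> 0) (at_left 0)"
      using cont by (simp add: continuous_within filterlim_at_split)
    have "((\<lambda>z. am * wfun h lam (- z)) \<longlongrightarrow> am * w0) (at_left 0)"
      using has_vector_derivative_continuous[OF left[of "{..<0}"]] by (simp add: continuous_within w0_def)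
    then show "(\<phi> \<longlongrightarrow> am * w0) (at_left 0)"
      by (rule Lim_transform_eventually) (auto simp: eventually_at_filter am)
  qed simp
  have "am = ap"
    using \<phi>0_ap \<phi>0_am \<open>w0 \<noteq> 0\<close> by simp
  have "ap \<noteq> 0"
  proof
    assume "ap = 0"
    then have "\<phi> z = 0" for z
      using ap[of z] am[of z] \<open>am = ap\<close> \<phi>0_ap by (cases z "0::real" rule: linorder_cases) auto
    with \<phi> show False
      by auto
  qed
  \<comment> \<open>One-sided derivatives at 0 are unique because 0 is a limit point of each
    half-line; \<open>\<phi>0_ap\<close> extends the formula for \<phi> to the end point.\<close>
  have "dp = ap * wfun' h lam 0"
  proof (rule vector_derivative_unique_within[OF _ dp])
    show "(\<phi> has_vector_derivative ap * wfun' h lam 0) (at 0 within {0..})"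
      by (rule has_vector_derivative_transform[OF _ _ right])
         (use \<phi>0_ap ap w0_def in \<open>auto simp: le_less\<close>)
  qed (simp add: at_within_Ici_at_right)
  moreover have "dm = - (ap * wfun' h lam 0)"
  proof (rule vector_derivative_unique_within[OF _ dm])
    show "(\<phi> has_vector_derivative - (ap * wfun' h lam 0)) (at 0 within {..0})"
      unfolding \<open>am = ap\<close>[symmetric]
      by (rule has_vector_derivative_transform[OF _ _ left])
         (use \<phi>0_am am w0_def in \<open>auto simp: le_less\<close>)
  qed (simp add: at_within_Iic_at_left)
  ultimately have "(of_real (2 * sqrt h) * Acoef lam - of_real s) * (ap * w0) = 0"
    using jump by (simp add: w'0 \<phi>0_ap algebra_simps)
  then have "of_real (2 * sqrt h) * Acoef lam = of_real s"
    using \<open>ap \<noteq> 0\<close> \<open>w0 \<noteq> 0\<close> by simp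
  then have "Acoef lam = of_real (s / (2 * sqrt h))"
    using \<open>h > 0\<close> by (simp add: field_simps)
  moreover have "s > 0"
    using \<phi>0_ap \<open>ap \<noteq> 0\<close> \<open>w0 \<noteq> 0\<close> by (simp add: s_def)
  then have "s / (2 * sqrt h) > 0"
    using \<open>h > 0\<close> by simp
  ultimately show ?thesis
    unfolding lam_def[symmetric] by (simp only: Reals_of_real Re_complex_of_real simp_thms)
qed

theorem theorem1p3:
  fixes p :: real
  assumes "p > 1"
  shows "(\<forall>h>0.
            (\<exists>!\<sigma>. \<sigma> \<in> {0<..<1} \<and> Acoef (lam_of h 1 \<sigma>) \<in> \<real> \<and> 0 < Re (Acoef (lam_of h 1 \<sigma>))) \<and>
            (\<forall>\<sigma>\<in>{0<..<1}. Acoef (lam_of h 1 \<sigma>) \<in> \<real> \<and> 0 < Re (Acoef (lam_of h 1 \<sigma>)) \<longrightarrow>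
               (\<exists>\<phi>. outgoing p h 1 \<sigma> \<phi> \<and> \<phi> \<noteq> (\<lambda>_. 0))))
       \<and> (\<forall>h>0. \<forall>\<sigma>\<in>{0<..<1}.
            \<not> (Acoef (lam_of h (-1) \<sigma>) \<in> \<real> \<and> 0 < Re (Acoef (lam_of h (-1) \<sigma>))) \<and>
            \<not> (\<exists>\<phi>. outgoing p h (-1) \<sigma> \<phi> \<and> \<phi> \<noteq> (\<lambda>_. 0)))"
proof (intro conjI allI impI ballI)
  fix h :: real assume h: "h > 0"
  let ?b = "1 / (2 * h)"
  have b: "?b > 0"
    using h by simp
  show "\<exists>!\<sigma>. \<sigma> \<in> {0<..<1} \<and> Acoef (lam_of h 1 \<sigma>) \<in> \<real> \<and> 0 < Re (Acoef (lam_of h 1 \<sigma>))"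
    unfolding Acoef_positive_iff[OF h]
  proof (rule ex_ex1I)
    obtain x where x: "x \<in> {- 1/4<..<1/4}" "gamma_phase ?b x = pi / 4"
      using ex_gamma_phase_eq_quarter_pi[OF b] by blast
    \<comment> \<open>The inverse of x = 1/4 - \<sigma>/2; it maps (-1/4, 1/4) onto (0, 1).\<close>
    have "1/4 - (1/2 - 2 * x) / 2 = x"
      by (simp add: field_simps)
    with x(2) have "gamma_phase ?b (1/4 - (1/2 - 2 * x) / 2) = pi / 4"
      by (simp only:)
    moreover have "1/2 - 2 * x \<in> {0<..<1}"
      using x(1) by auto
    ultimately show "\<exists>\<sigma>. \<sigma> \<in> {0<..<1} \<and> gamma_phase ?b (1/4 - \<sigma> / 2) = pi / 4"
      by blast
  next
    \<comment> \<open>For parameters below 1 the points 1/4 - \<sigma>/2 and 1/4 - \<tau>/2 exceed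
      -1/4, so strict monotonicity of the phase excludes two different solutions.\<close>
    fix \<sigma> \<tau>
    assume \<sigma>: "\<sigma> \<in> {0<..<1} \<and> gamma_phase ?b (1/4 - \<sigma> / 2) = pi / 4"
      and \<tau>: "\<tau> \<in> {0<..<1} \<and> gamma_phase ?b (1/4 - \<tau> / 2) = pi / 4"
    show "\<sigma> = \<tau>"
    proof (cases \<sigma> \<tau> rule: linorder_cases)
      case less
      then show ?thesis
        using \<sigma> \<tau> gamma_phase_strict_antimono[OF b, of "1/4 - \<tau> / 2" "1/4 - \<sigma> / 2"] by simp
    next
      case greater
      then show ?thesis
        using \<sigma> \<tau> gamma_phase_strict_antimono[OF b, of "1/4 - \<sigma> / 2" "1/4 - \<tau> / 2"] by simp
    qed
  qed
next
  fix h \<sigma> :: real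
  assume "h > 0" "Acoef (lam_of h 1 \<sigma>) \<in> \<real> \<and> 0 < Re (Acoef (lam_of h 1 \<sigma>))"
  then show "\<exists>\<phi>. outgoing p h 1 \<sigma> \<phi> \<and> \<phi> \<noteq> (\<lambda>_. 0)"
    using assms by (intro outgoing_exists) auto
next
  fix h \<sigma> :: real
  assume h: "h > 0"
  show "\<not> (Acoef (lam_of h (-1) \<sigma>) \<in> \<real> \<and> 0 < Re (Acoef (lam_of h (-1) \<sigma>)))"
    using Acoef_not_positive[OF h] .
  then show "\<not> (\<exists>\<phi>. outgoing p h (-1) \<sigma> \<phi> \<and> \<phi> \<noteq> (\<lambda>_. 0))"
    using outgoing_imp_Acoef_positive[OF h, of "-1" p \<sigma>] by auto
qed

end
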